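(* The round robin rule does not satisfy EF1: there exists an instance $I=(N,O,U)$ with additive utilities on which the round robin rule (for some order of the agents and some tie-breaking) produces an allocation that is not EF1.
   Context: An instance is a triple $I=(N,O,U)$ where $N=\{1,\dots,n\}$ is a set of agents, $O=\{o_1,\dots,o_m\}$ is a finite set of indivisible items, and $U$ is an $n$-tuple of utility functions $u_i:2^O\to\mathbb{R}$. Write $u_i(o)=u_i(\{o\})$; utilities may be positive, zero or negative. Utilities are additive: $u_i(X)=\sum_{o\in X}u_i(o)$ for every $X\subseteq O$. An allocation is a function $\pi:N\to 2^O$ with $\bigcup_{i\in N}\pi(i)=O$ and $\pi(i)\cap\pi(j)=\emptyset$ for distinct $i,j$. Agent $i$ envies $j$ if $u_i(\pi(i))<u_i(\pi(j))$. Agent $i$ envies $j$ by more than one item if $i$ envies $j$ and $u_i(\pi(i)\setminus\{o\})<u_i(\pi(j)\setminus\{o\})$ for every item $o\in\pi(i)\cup\pi(j)$. The allocation $\pi$ is envy-free up to one item (EF1) if for all $i,j\in N$, $i$ does not envy $j$ by more than one item. The round robin rule: the agents take turns cyclically in a fixed order, and each agent on her turn takes a most preferred (highest-utility for her) item among the unallocated ones, until all items are allocated. *)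

theory Defs
  imports Complex_Main
begin

record 'a allocation_instance =
  num_agents :: nat
  items :: "'a set"
  utility :: "nat \<Rightarrow> 'a set \<Rightarrow> real"

definition agents :: "'a allocation_instance \<Rightarrow> nat set" where
  "agents I = {1..num_agents I}"

text \<open>Utilities are total functions on sets; only their values for agents and for subsets of the
  item set are meaningful.\<close>

definition well_formed :: "'a allocation_instance \<Rightarrow> bool" where
  "well_formed I \<longleftrightarrow> num_agents I \<ge> 1 \<and> finite (items I)"

definition additive_utilities :: "'a allocation_instance \<Rightarrow> bool" where
  "additive_utilities I \<longleftrightarrow>
    (\<forall>i\<in>agents I. \<forall>X. X \<subseteq> items I \<longrightarrow> utility I i X = (\<Sum>x\<in>X. utility I i {x}))"

definition allocation :: "'a allocation_instance \<Rightarrow> (nat \<Rightarrow> 'a set) \<Rightarrow> bool" where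
  "allocation I \<pi> \<longleftrightarrow>
    (\<Union>i\<in>agents I. \<pi> i) = items I \<and>
    (\<forall>i\<in>agents I. \<forall>j\<in>agents I. i \<noteq> j \<longrightarrow> \<pi> i \<inter> \<pi> j = {})"

definition envies :: "'a allocation_instance \<Rightarrow> (nat \<Rightarrow> 'a set) \<Rightarrow> nat \<Rightarrow> nat \<Rightarrow> bool" where
  "envies I \<pi> i j \<longleftrightarrow> utility I i (\<pi> i) < utility I i (\<pi> j)"

definition envies_by_more_than_one_item ::
  "'a allocation_instance \<Rightarrow> (nat \<Rightarrow> 'a set) \<Rightarrow> nat \<Rightarrow> nat \<Rightarrow> bool" where
  "envies_by_more_than_one_item I \<pi> i j \<longleftrightarrow>
    envies I \<pi> i j \<and>
    (\<forall>x\<in>\<pi> i \<union> \<pi> j. utility I i (\<pi> i - {x}) < utility I i (\<pi> j - {x}))"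

definition EF1 :: "'a allocation_instance \<Rightarrow> (nat \<Rightarrow> 'a set) \<Rightarrow> bool" where
  "EF1 I \<pi> \<longleftrightarrow>
    (\<forall>i\<in>agents I. \<forall>j\<in>agents I. \<not> envies_by_more_than_one_item I \<pi> i j)"

definition agent_order :: "'a allocation_instance \<Rightarrow> nat list \<Rightarrow> bool" where
  "agent_order I \<sigma> \<longleftrightarrow> distinct \<sigma> \<and> set \<sigma> = agents I"

definition most_preferred :: "'a allocation_instance \<Rightarrow> nat \<Rightarrow> 'a set \<Rightarrow> 'a \<Rightarrow> bool" where
  "most_preferred I i R x \<longleftrightarrow> x \<in> R \<and> (\<forall>y\<in>R. utility I i {y} \<le> utility I i {x})"

text \<open>In \<open>round_robin_state I \<sigma> k R \<pi>\<close>, \<open>k\<close> turns have been taken, \<open>R\<close> is the set of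
  unallocated items and \<open>\<pi>\<close> is the partial allocation built so far. Ties are broken
  nondeterministically.\<close>

inductive round_robin_state ::
  "'a allocation_instance \<Rightarrow> nat list \<Rightarrow> nat \<Rightarrow> 'a set \<Rightarrow> (nat \<Rightarrow> 'a set) \<Rightarrow> bool"
  for I :: "'a allocation_instance" and \<sigma> :: "nat list" where
  start: "round_robin_state I \<sigma> 0 (items I) (\<lambda>_. {})"
| turn: "\<lbrakk>round_robin_state I \<sigma> k R \<pi>; i = \<sigma> ! (k mod length \<sigma>); most_preferred I i R x\<rbrakk>
    \<Longrightarrow> round_robin_state I \<sigma> (Suc k) (R - {x}) (\<pi>(i := insert x (\<pi> i)))"

definition round_robin_outcome ::
  "'a allocation_instance \<Rightarrow> nat list \<Rightarrow> (nat \<Rightarrow> 'a set) \<Rightarrow> bool" where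
  "round_robin_outcome I \<sigma> \<pi> \<longleftrightarrow> (\<exists>k. round_robin_state I \<sigma> k {} \<pi>)"

end

theory Submission
  imports Defs
begin

text \<open>Two agents share one good worth \<open>1\<close> and three chores worth \<open>-1\<close>. The first agent takes the good
  and one chore (total \<open>0\<close>), the second is left with two chores (total \<open>-2\<close>). Deleting a chore of the
  second agent only raises her to \<open>-1 < 0\<close>, and deleting the good only lowers the first bundle
  to \<open>-1 > -2\<close>: a good and a chore would both have to be removed.\<close>

definition item_value :: "nat \<Rightarrow> real" where
  "item_value x = (if x = 0 then 1 else -1)"

definition mixed_instance :: "nat allocation_instance" where
  "mixed_instance = \<lparr>num_agents = 2, items = {0, 1, 2, 3}, utility = (\<lambda>_. sum item_value)\<rparr>"

text \<open>Arises when agent 1 moves first and ties among the equally bad chores go to the smallest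
  index.\<close>

definition mixed_allocation :: "nat \<Rightarrow> nat set" where
  "mixed_allocation = (\<lambda>_. {})(1 := {0, 2}, 2 := {1, 3})"

lemma agents_mixed_instance: "agents mixed_instance = {1, 2}"
  by (auto simp: agents_def mixed_instance_def)

lemma round_robin_outcome_mixed_instance:
  "round_robin_outcome mixed_instance [1, 2] mixed_allocation"
proof -
  let ?S = "round_robin_state mixed_instance [1, 2]"
  \<comment> \<open>One turn without utilities: the good \<open>0\<close> beats every chore, and
    once it is gone all remaining items tie. The equations for \<open>R'\<close> and
    \<open>\<pi>'\<close> let each new state be given in simplified form.\<close>
  have pick: "?S (Suc k) R' \<pi>'"
    if S: "?S k R \<pi>" and i: "[1, 2] ! (k mod 2) = i" and x: "x \<in> R" "x = 0 \<or> 0 \<notin> R"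
      and R': "R - {x} = R'" and \<pi>': "\<pi>(i := insert x (\<pi> i)) = \<pi>'" for k R R' \<pi> \<pi>' i x
  proof -
    have "item_value y \<le> item_value x" if "y \<in> R" for y
      using x that by (cases "y = 0") (auto simp: item_value_def)
    then have "most_preferred mixed_instance i R x"
      using x by (simp add: most_preferred_def mixed_instance_def)
    moreover have "i = [1, 2] ! (k mod length [1, 2 :: nat])"
      unfolding i[symmetric] by (simp add: numeral_2_eq_2)
    ultimately show ?thesis
      using round_robin_state.turn[OF S] unfolding R'[symmetric] \<pi>'[symmetric] by blast
  qed
  have "?S 0 {0, 1, 2, 3} (\<lambda>_. {})"
    using round_robin_state.start[of mixed_instance "[1, 2]"] by (simp add: mixed_instance_def)
  then have "?S (Suc 0) {1, 2, 3} ((\<lambda>_. {})(1 := {0}))"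
    by (rule pick[where i = 1 and x = 0]) auto
  then have "?S (Suc (Suc 0)) {2, 3} ((\<lambda>_. {})(1 := {0}, 2 := {1}))"
    by (rule pick[where i = 2 and x = 1]) auto
  \<comment> \<open>The new update at \<open>1\<close> lies outside the one at \<open>2\<close>, so
    the functions are compared pointwise.\<close>
  then have "?S (Suc (Suc (Suc 0))) {3} ((\<lambda>_. {})(1 := {0, 2}, 2 := {1}))"
    by (rule pick[where i = 1 and x = 2]) (auto simp: fun_eq_iff)
  then have "?S (Suc (Suc (Suc (Suc 0)))) {} mixed_allocation"
    by (rule pick[where i = 2 and x = 3]) (auto simp: fun_eq_iff mixed_allocation_def)
  then show ?thesis
    by (auto simp: round_robin_outcome_def)
qed

lemma not_EF1_mixed_allocation: "\<not> EF1 mixed_instance mixed_allocation"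
proof -
  \<comment> \<open>Envy is -2 < 0; deleting \<open>0\<close>, \<open>2\<close>, or one of
    \<open>1\<close>, \<open>3\<close> gives -2 < -1, -2 < 1, or -1 < 0.\<close>
  have "envies_by_more_than_one_item mixed_instance mixed_allocation 2 1"
    by (simp add: envies_by_more_than_one_item_def envies_def mixed_instance_def
        mixed_allocation_def item_value_def insert_Diff_if)
  then show ?thesis
    by (auto simp: EF1_def agents_mixed_instance)
qed

theorem proposition3:
  shows "\<exists>(I :: nat allocation_instance) \<sigma> \<pi>.
    well_formed I \<and> additive_utilities I \<and> agent_order I \<sigma> \<and>
    round_robin_outcome I \<sigma> \<pi> \<and> allocation I \<pi> \<and> \<not> EF1 I \<pi>"
proof (intro exI conjI)
  show "well_formed mixed_instance"
    by (simp add: well_formed_def mixed_instance_def)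
  show "additive_utilities mixed_instance"
    by (simp add: additive_utilities_def mixed_instance_def)
  show "agent_order mixed_instance [1, 2]"
    by (simp add: agent_order_def agents_mixed_instance)
  show "allocation mixed_instance mixed_allocation"
    unfolding allocation_def agents_mixed_instance
    by (auto simp: mixed_instance_def mixed_allocation_def)
qed (fact round_robin_outcome_mixed_instance not_EF1_mixed_allocation)+

end
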